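(* Consider the bivariate scale model with order restriction $\theta_1\le\theta_2$, scaled squared error loss for estimating $\theta_1$, and, for a fixed $\nu>0$, the class $\mathcal{D}_{1,\nu}=\{\delta_\alpha:\alpha\in\mathbb{R}\}$ of estimators of $\theta_1$, with $c_{0,1}$, $f_Z$, $\psi_2$, $\psi$, $k_1$, $\alpha_1(\cdot)$ all as defined in the context. Put $\alpha_{1,1}=\alpha_1(1)$ and $\alpha_{1,\infty}=\lim_{\lambda\to\infty}\alpha_1(\lambda)\in[-\infty,\infty]$. (a) Suppose that $\psi$ is decreasing on $(0,\frac{c_{0,1}}{\nu})$ and that one of the following holds: (i) for every fixed $\theta\in(0,1)$, $t\mapsto\frac{\psi_2(\theta t)}{\psi_2(t)}$ and $t\mapsto\frac{f_Z(\theta t)}{f_Z(t)}$ are increasing on $(0,\frac{c_{0,1}}{\nu})$, and, for every $\lambda\ge1$, $z\mapsto k_1(z,\lambda)$ is increasing on $(0,1)$; or (ii) for every fixed $\theta\in(0,1)$, these two ratios are decreasing in $t$ on $(0,\frac{c_{0,1}}{\nu})$, and, for every $\lambda\ge1$, $z\mapsto k_1(z,\lambda)$ is decreasing on $(0,1)$. Then the estimators that are admissible within the class $\mathcal{D}_{1,\nu}$ are exactly those $\delta_\alpha$ with $\alpha\in\mathbb{R}$, $\alpha_{1,1}\le\alpha\le\alpha_{1,\infty}$. Moreover, if $-\infty<a<b\le\alpha_{1,1}$ or $\alpha_{1,\infty}\le b<a<\infty$, then $\delta_b$ dominates $\delta_a$, i.e. $R_1(\underline\theta,\delta_b)\le R_1(\underline\theta,\delta_a)$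 for all $\underline\theta\in\Theta_0$. (b) Suppose that $\psi$ is increasing on $(0,\frac{c_{0,1}}{\nu})$ and that one of the following holds: (i) for every fixed $\theta\in(0,1)$, $t\mapsto\frac{\psi_2(\theta t)}{\psi_2(t)}$ and $t\mapsto\frac{f_Z(\theta t)}{f_Z(t)}$ are increasing on $(0,\frac{c_{0,1}}{\nu})$, and, for every $\lambda\ge1$, $z\mapsto k_1(z,\lambda)$ is decreasing on $(0,1)$; or (ii) for every fixed $\theta\in(0,1)$, these two ratios are decreasing in $t$ on $(0,\frac{c_{0,1}}{\nu})$, and, for every $\lambda\ge1$, $z\mapsto k_1(z,\lambda)$ is increasing on $(0,1)$. Then the estimators that are admissible within the class $\mathcal{D}_{1,\nu}$ are exactly those $\delta_\alpha$ with $\alpha\in\mathbb{R}$, $\alpha_{1,\infty}\le\alpha\le\alpha_{1,1}$. Moreover, if $-\infty<a<b\le\alpha_{1,\infty}$ or $\alpha_{1,1}\le b<a<\infty$, then $\delta_b$ dominates $\delta_a$, i.e. $R_1(\underline\theta,\delta_b)\le R_1(\underline\theta,\delta_a)$ for all $\underline\theta\in\Theta_0$.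
   Context: Model: $f$ is a fixed Lebesgue probability density supported in $(0,\infty)^2$ and $\underline X=(X_1,X_2)$ has density $\frac{1}{\theta_1\theta_2}f\left(\frac{x_1}{\theta_1},\frac{x_2}{\theta_2}\right)$ with unknown $\underline\theta=(\theta_1,\theta_2)\in\Theta_0=\{(t_1,t_2)\in(0,\infty)^2:t_1\le t_2\}$. Put $\lambda=\theta_2/\theta_1\ge1$, $Z_i=X_i/\theta_i$ ($i=1,2$), $Z=Z_2/Z_1$; the pair $(Z_1,Z_2)$ has density $f$ whatever $\underline\theta$ is. It is assumed that $E[Z_1^2],E[Z_2^2]<\infty$. $c_{0,1}=E[Z_1]/E[Z_1^2]$ (so $c_{0,1}X_1$ is the best scale equivariant estimator of $\theta_1$). $\nu>0$ is a fixed constant. Estimators: for $\alpha\in\mathbb{R}$, $$\delta_\alpha(\underline X)=\begin{cases}c_{0,1}X_1,&\text{if }c_{0,1}X_1\le \nu X_2,\\ \alpha c_{0,1}X_1+(1-\alpha)\nu X_2,&\text{if }c_{0,1}X_1>\nu X_2,\end{cases}$$ and $\mathcal{D}_{1,\nu}=\{\delta_\alpha:\alpha\in\mathbb{R}\}$. Risk: $R_1(\underline\theta,\delta)=E_{\underline\theta}\left[\left(\frac{\delta(\underline X)}{\theta_1}-1\right)^2\right]$, $\underline\theta\in\Theta_0$. An estimator $\delta\in\mathcal{D}_{1,\nu}$ is admissible within $\mathcal{D}_{1,\nu}$ if there is no $\delta'\in\mathcal{D}_{1,\nu}$ with $R_1(\underline\theta,\delta')\le R_1(\underline\theta,\delta)$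 for all $\underline\theta\in\Theta_0$ and strict inequality for some $\underline\theta\in\Theta_0$. Functions: $f_Z(z)=\int_0^\infty s f(s,sz)\,ds$, $z>0$, is the density of $Z$; for $r=1,2$, $\psi_r(z)=E[Z_1^r\mid Z=z]=\int_0^\infty s^{r+1}f(s,sz)\,ds\,/\,\int_0^\infty s f(s,sz)\,ds$; $\psi(z)=\psi_1(z)/\psi_2(z)$. It is assumed that $0<f_Z(z)<\infty$ and that $\psi_1(z),\psi_2(z)$ are well defined (finite) for all $z\in(0,\frac{c_{0,1}}{\nu})$. For $0<z<1$, $\lambda\ge1$, $$k_1(z,\lambda)=\frac{\psi\left(\frac{c_{0,1}z}{\nu\lambda}\right)-c_{0,1}}{1-z}.$$ For $\lambda\ge1$, with $I_A$ the indicator of $A$, $$\alpha_1(\lambda)=1+\frac{E[(c_{0,1}Z_1-\nu\lambda Z_2)(1-c_{0,1}Z_1)I_{(0,\frac{c_{0,1}}{\lambda\nu})}(Z)]}{E[(c_{0,1}Z_1-\nu\lambda Z_2)^2I_{(0,\frac{c_{0,1}}{\lambda\nu})}(Z)]}.$$ "Increasing" means non-decreasing and "decreasing" means non-increasing. *)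

theory Defs
  imports "HOL-Probability.Probability"
begin

definition Theta0 :: "(real \<times> real) set" where
  "Theta0 = {(t1, t2). 0 < t1 \<and> t1 \<le> t2}"

definition law_X :: "(real \<times> real \<Rightarrow> real) \<Rightarrow> real \<times> real \<Rightarrow> (real \<times> real) measure" where
  "law_X f \<theta> = density lborel
     (\<lambda>x. ennreal (1 / (fst \<theta> * snd \<theta>) * f (fst x / fst \<theta>, snd x / snd \<theta>)))"

text \<open>The law of \<open>(Z\<^sub>1, Z\<^sub>2) = (X\<^sub>1 / \<theta>\<^sub>1, X\<^sub>2 / \<theta>\<^sub>2)\<close>, which does not depend on \<open>\<theta>\<close>.
  A point \<open>z\<close> of this space is a value of the pair, so that \<open>Z\<^sub>1\<close>, \<open>Z\<^sub>2\<close> and \<open>Z\<close> are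
  \<open>fst z\<close>, \<open>snd z\<close> and \<open>snd z / fst z\<close>.\<close>

definition law_Z :: "(real \<times> real \<Rightarrow> real) \<Rightarrow> (real \<times> real) measure" where
  "law_Z f = density lborel (\<lambda>z. ennreal (f z))"

definition c01 :: "(real \<times> real \<Rightarrow> real) \<Rightarrow> real" where
  "c01 f = (LINT z|law_Z f. fst z) / (LINT z|law_Z f. (fst z)\<^sup>2)"

definition delta :: "(real \<times> real \<Rightarrow> real) \<Rightarrow> real \<Rightarrow> real \<Rightarrow> real \<times> real \<Rightarrow> real" where
  "delta f \<nu> \<alpha> x =
     (if c01 f * fst x \<le> \<nu> * snd x then c01 f * fst x
      else \<alpha> * c01 f * fst x + (1 - \<alpha>) * \<nu> * snd x)"

definition D1 :: "(real \<times> real \<Rightarrow> real) \<Rightarrow> real \<Rightarrow> (real \<times> real \<Rightarrow> real) set" where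
  "D1 f \<nu> = range (delta f \<nu>)"

definition R1 :: "(real \<times> real \<Rightarrow> real) \<Rightarrow> real \<times> real \<Rightarrow> (real \<times> real \<Rightarrow> real) \<Rightarrow> real" where
  "R1 f \<theta> \<delta> = (LINT x|law_X f \<theta>. (\<delta> x / fst \<theta> - 1)\<^sup>2)"

definition admissible_within ::
    "(real \<times> real \<Rightarrow> real) \<Rightarrow> (real \<times> real \<Rightarrow> real) set \<Rightarrow> (real \<times> real \<Rightarrow> real) \<Rightarrow> bool" where
  "admissible_within f D \<delta> \<longleftrightarrow> \<delta> \<in> D \<and>
     \<not> (\<exists>\<delta>'\<in>D. (\<forall>\<theta>\<in>Theta0. R1 f \<theta> \<delta>' \<le> R1 f \<theta> \<delta>) \<and> (\<exists>\<theta>\<in>Theta0. R1 f \<theta> \<delta>' < R1 f \<theta> \<delta>))"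

definition f_Z :: "(real \<times> real \<Rightarrow> real) \<Rightarrow> real \<Rightarrow> real" where
  "f_Z f z = (LINT s:{0<..}|lborel. s * f (s, s * z))"

definition psi_r :: "(real \<times> real \<Rightarrow> real) \<Rightarrow> nat \<Rightarrow> real \<Rightarrow> real" where
  "psi_r f r z = (LINT s:{0<..}|lborel. s ^ (r + 1) * f (s, s * z)) /
                 (LINT s:{0<..}|lborel. s * f (s, s * z))"

definition psi :: "(real \<times> real \<Rightarrow> real) \<Rightarrow> real \<Rightarrow> real" where
  "psi f z = psi_r f 1 z / psi_r f 2 z"

definition k1 :: "(real \<times> real \<Rightarrow> real) \<Rightarrow> real \<Rightarrow> real \<Rightarrow> real \<Rightarrow> real" where
  "k1 f \<nu> z l = (psi f (c01 f * z / (\<nu> * l)) - c01 f) / (1 - z)"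

definition alpha1 :: "(real \<times> real \<Rightarrow> real) \<Rightarrow> real \<Rightarrow> real \<Rightarrow> real" where
  "alpha1 f \<nu> l = 1 +
     (LINT z|law_Z f. (c01 f * fst z - \<nu> * l * snd z) * (1 - c01 f * fst z) *
        indicator {0<..<c01 f / (l * \<nu>)} (snd z / fst z)) /
     (LINT z|law_Z f. (c01 f * fst z - \<nu> * l * snd z)\<^sup>2 *
        indicator {0<..<c01 f / (l * \<nu>)} (snd z / fst z))"

definition alpha1_inf :: "(real \<times> real \<Rightarrow> real) \<Rightarrow> real \<Rightarrow> ereal" where
  "alpha1_inf f \<nu> = Lim at_top (\<lambda>l. ereal (alpha1 f \<nu> l))"

end

theory Submission
  imports Defs
begin

text \<open>At \<open>\<lambda> = \<theta>\<^sub>2 / \<theta>\<^sub>1\<close> the risk of \<open>\<delta>\<^sub>\<alpha>\<close> is a quadratic polynomial in \<open>\<alpha>\<close> with positive leading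
  coefficient and minimum at \<open>\<alpha>\<^sub>1(\<lambda>)\<close>, so one estimator is at least as good as another iff its
  parameter is at least as close to every \<open>\<alpha>\<^sub>1(\<lambda>)\<close>. Once \<open>\<alpha>\<^sub>1\<close> is monotone, the undominated
  parameters are therefore those between \<open>\<alpha>\<^sub>1(1)\<close> and the limit of \<open>\<alpha>\<^sub>1\<close> (continuity of \<open>\<alpha>\<^sub>1\<close> plays
  no part).

  For the monotonicity, condition on \<open>Z\<close> and substitute \<open>Z = c\<^sub>0\<^sub>1 t / (\<nu> \<lambda>)\<close>: then
  \<open>c\<^sub>0\<^sub>1 (\<alpha>\<^sub>1(\<lambda>) - 1)\<close> is the mean of \<open>k\<^sub>1(t, \<lambda>)\<close> over \<open>t \<in> (0,1)\<close> under the weight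
  \<open>(1 - t)\<^sup>2 \<psi>\<^sub>2 f\<^sub>Z\<close> taken at \<open>c\<^sub>0\<^sub>1 t / (\<nu> \<lambda>)\<close>. Monotonicity of \<open>\<psi>\<close> compares the integrands at two
  values of \<open>\<lambda>\<close>, and Chebyshev's correlation inequality compares the weights, whose ratio is
  the product of the ratios of \<open>\<psi>\<^sub>2\<close> and of \<open>f\<^sub>Z\<close>.\<close>

section \<open>Correlation inequality for set integrals\<close>

text \<open>Integrating \<open>assoc\<close> over \<open>s\<close> and then over \<open>t\<close>
  yields twice the difference of the two sides. Each one-variable integral is a linear combination
  of the four given ones, so no product measure enters.\<close>

lemma set_integral_correlation:
  fixes k w1 w2 :: "'a \<Rightarrow> real"
  assumes A: "A \<in> sets M"
    and w1: "set_integrable M A w1" and w2: "set_integrable M A w2"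
    and kw1: "set_integrable M A (\<lambda>t. k t * w1 t)" and kw2: "set_integrable M A (\<lambda>t. k t * w2 t)"
    and assoc: "\<And>s t. s \<in> A \<Longrightarrow> t \<in> A \<Longrightarrow> 0 \<le> (k s - k t) * (w2 s * w1 t - w2 t * w1 s)"
  shows "(LINT t:A|M. k t * w1 t) * (LINT t:A|M. w2 t) \<le> (LINT t:A|M. k t * w2 t) * (LINT t:A|M. w1 t)"
proof -
  define W1 where "W1 = (LINT t:A|M. w1 t)"
  define W2 where "W2 = (LINT t:A|M. w2 t)"
  define K1 where "K1 = (LINT t:A|M. k t * w1 t)"
  define K2 where "K2 = (LINT t:A|M. k t * w2 t)"
  note [simp] = W1_def[symmetric] W2_def[symmetric] K1_def[symmetric] K2_def[symmetric]
  have inner: "0 \<le> K2 * w1 t + W1 * (k t * w2 t) - (K1 * w2 t + W2 * (k t * w1 t))" if "t \<in> A" for t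
  proof -
    have "0 \<le> (LINT s:A|M. (k s * w2 s) * w1 t + w1 s * (k t * w2 t)
        - ((k s * w1 s) * w2 t + w2 s * (k t * w1 t)))"
      using assoc[OF _ that]
      by (auto simp: set_lebesgue_integral_def indicator_def algebra_simps intro!: Bochner_Integration.integral_nonneg)
    also have "\<dots> = K2 * w1 t + W1 * (k t * w2 t) - (K1 * w2 t + W2 * (k t * w1 t))"
      using w1 w2 kw1 kw2 by (simp add: set_integral_diff set_integral_add)
    finally show ?thesis .
  qed
  have "0 \<le> (LINT t:A|M. K2 * w1 t + W1 * (k t * w2 t) - (K1 * w2 t + W2 * (k t * w1 t)))"
    using inner by (auto simp: set_lebesgue_integral_def indicator_def intro!: Bochner_Integration.integral_nonneg)
  also have "\<dots> = K2 * W1 + W1 * K2 - (K1 * W2 + W2 * K1)"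
    using w1 w2 kw1 kw2 by (simp add: set_integral_diff set_integral_add)
  finally show ?thesis by simp
qed

lemma borel_measurable_fst_snd [measurable]:
  "(fst :: real \<times> real \<Rightarrow> real) \<in> borel_measurable borel"
  "(snd :: real \<times> real \<Rightarrow> real) \<in> borel_measurable borel"
  by (intro borel_measurable_continuous_onI continuous_intros)+

section \<open>Undominated parameters for a monotone family of minimisers\<close>

text \<open>Here \<open>A l\<close> stands for the minimiser of the quadratic risk at ratio
  \<open>l\<close>, so distance to \<open>A l\<close> orders the risks and this becomes
  \<open>admissible_within\<close> in terms of parameters.\<close>

definition undominated :: "(real \<Rightarrow> real) \<Rightarrow> real \<Rightarrow> bool" where
  "undominated A \<alpha> \<longleftrightarrow>
     \<not> (\<exists>\<beta>. (\<forall>l\<ge>1. \<bar>\<beta> - A l\<bar> \<le> \<bar>\<alpha> - A l\<bar>) \<and> (\<exists>l\<ge>1. \<bar>\<beta> - A l\<bar> < \<bar>\<alpha> - A l\<bar>))"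

text \<open>\<open>Lim\<close> is a definite description and says something only once convergence is
  known; the supremum, possibly infinite, supplies the limit.\<close>

lemma tendsto_SUP_mono_on:
  fixes A :: "real \<Rightarrow> real"
  assumes "mono_on {1..} A"
  shows "((\<lambda>l. ereal (A l)) \<longlongrightarrow> (SUP l\<in>{1..}. ereal (A l))) at_top"
proof (rule order_tendstoI)
  fix a assume "a < (SUP l\<in>{1..}. ereal (A l))"
  then obtain l0 where l0: "1 \<le> l0" "a < ereal (A l0)" by (auto simp: less_SUP_iff)
  show "\<forall>\<^sub>F l in at_top. a < ereal (A l)"
    using eventually_ge_at_top[of l0]
  proof eventually_elim
    case (elim l)
    then have "A l0 \<le> A l" using l0 assms by (auto simp: mono_on_def)
    then show ?case using l0 by (metis ereal_less_eq(3) less_le_trans)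
  qed
next
  fix a assume a: "(SUP l\<in>{1..}. ereal (A l)) < a"
  show "\<forall>\<^sub>F l in at_top. ereal (A l) < a"
    using eventually_ge_at_top[of 1]
  proof eventually_elim
    case (elim l)
    then have "ereal (A l) \<le> (SUP l\<in>{1..}. ereal (A l))" by (intro SUP_upper) auto
    then show ?case using a by simp
  qed
qed

text \<open>All \<open>A l\<close> lie between \<open>A 1\<close> and \<open>L\<close> and come
  arbitrarily close to \<open>L\<close>. From outside this range, moving to the nearer endpoint
  approaches every \<open>A l\<close>; from inside, moving up is worse at 1 and moving down is worse
  for some large \<open>l\<close>.\<close>

lemma mono_optimum:
  fixes A :: "real \<Rightarrow> real"
  assumes mono: "mono_on {1..} A"
  defines "L \<equiv> Lim at_top (\<lambda>l. ereal (A l))"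
  shows "((\<lambda>l. ereal (A l)) \<longlongrightarrow> L) at_top"
    and "undominated A \<alpha> \<longleftrightarrow> ereal (A 1) \<le> ereal \<alpha> \<and> ereal \<alpha> \<le> L"
    and "(a < b \<and> ereal b \<le> ereal (A 1)) \<or> (L \<le> ereal b \<and> b < a) \<Longrightarrow> 1 \<le> l \<Longrightarrow> \<bar>b - A l\<bar> \<le> \<bar>a - A l\<bar>"
proof -
  have L: "L = (SUP l\<in>{1..}. ereal (A l))"
    unfolding L_def by (rule tendsto_Lim[OF _ tendsto_SUP_mono_on[OF mono]]) simp
  show "((\<lambda>l. ereal (A l)) \<longlongrightarrow> L) at_top"
    using tendsto_SUP_mono_on[OF mono] L by simp
  have lo: "A 1 \<le> A l" if "1 \<le> l" for l using mono that by (auto simp: mono_on_def)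
  have up: "ereal (A l) \<le> L" if "1 \<le> l" for l unfolding L using that by (intro SUP_upper) auto
  show dom: "\<bar>b - A l\<bar> \<le> \<bar>a - A l\<bar>"
    if "(a < b \<and> ereal b \<le> ereal (A 1)) \<or> (L \<le> ereal b \<and> b < a)" "1 \<le> l" for a b l
    using that(1)
  proof
    assume "a < b \<and> ereal b \<le> ereal (A 1)"
    then show ?thesis using lo[OF that(2)] by auto
  next
    assume *: "L \<le> ereal b \<and> b < a"
    then have "ereal (A l) \<le> ereal b" using up[OF that(2)] by (metis order_trans)
    then show ?thesis using * by auto
  qed
  show "undominated A \<alpha> \<longleftrightarrow> ereal (A 1) \<le> ereal \<alpha> \<and> ereal \<alpha> \<le> L"
  proof
    assume u: "undominated A \<alpha>"
    show "ereal (A 1) \<le> ereal \<alpha> \<and> ereal \<alpha> \<le> L"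
    proof (rule ccontr)
      assume "\<not> ?thesis"
      then consider "\<alpha> < A 1" | "L < ereal \<alpha>" by fastforce
      \<comment> \<open>The competitor is the endpoint that was overstepped; if it is
        \<open>L\<close>, then \<open>L\<close> is finite, lying between \<open>A 1\<close> and
        \<open>\<alpha>\<close>.\<close>
      then obtain \<beta> where \<beta>: "(\<alpha> < \<beta> \<and> ereal \<beta> = ereal (A 1)) \<or> (L = ereal \<beta> \<and> \<beta> < \<alpha>)"
      proof cases
        case 1 then show ?thesis using that by auto
      next
        case 2
        then obtain \<beta> where "L = ereal \<beta>" using up[of 1] by (cases L) auto
        then show ?thesis using that 2 by auto
      qed
      have "\<bar>\<beta> - A 1\<bar> < \<bar>\<alpha> - A 1\<bar>"
        using \<beta> up[of 1] by auto
      moreover have "\<forall>l\<ge>1. \<bar>\<beta> - A l\<bar> \<le> \<bar>\<alpha> - A l\<bar>" using dom[of \<alpha> \<beta>] \<beta> by auto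
      ultimately show False using u unfolding undominated_def by auto
    qed
  next
    assume \<alpha>: "ereal (A 1) \<le> ereal \<alpha> \<and> ereal \<alpha> \<le> L"
    show "undominated A \<alpha>"
      unfolding undominated_def
    proof clarify
      fix \<beta> l assume le: "\<forall>l\<ge>1. \<bar>\<beta> - A l\<bar> \<le> \<bar>\<alpha> - A l\<bar>" and "\<bar>\<beta> - A l\<bar> < \<bar>\<alpha> - A l\<bar>"
      then have "\<alpha> \<noteq> \<beta>" by auto
      moreover have "\<bar>\<beta> - A 1\<bar> \<le> \<bar>\<alpha> - A 1\<bar>" using le by simp
      ultimately have "\<beta> < \<alpha>" using \<alpha> by auto
      \<comment> \<open>Any \<open>A l'\<close> above the midpoint is strictly closer to
        \<open>\<alpha>\<close> than to \<open>\<beta>\<close>.\<close>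
      then have "ereal ((\<alpha> + \<beta>) / 2) < ereal \<alpha>" by simp
      also have "\<dots> \<le> L" using \<alpha> by simp
      finally have "ereal ((\<alpha> + \<beta>) / 2) < L" .
      then obtain l' where "1 \<le> l'" "(\<alpha> + \<beta>) / 2 < A l'" unfolding L by (auto simp: less_SUP_iff)
      then show False using le \<open>\<beta> < \<alpha>\<close> by (auto dest!: spec[of _ l'])
    qed
  qed
qed

lemma undominated_uminus: "undominated (\<lambda>l. - A l) (- \<alpha>) \<longleftrightarrow> undominated A \<alpha>"
proof -
  have "(\<exists>\<beta>. (\<forall>l\<ge>1. \<bar>\<beta> - - A l\<bar> \<le> \<bar>- \<alpha> - - A l\<bar>) \<and> (\<exists>l\<ge>1. \<bar>\<beta> - - A l\<bar> < \<bar>- \<alpha> - - A l\<bar>)) \<longleftrightarrow>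
    (\<exists>\<beta>. (\<forall>l\<ge>1. \<bar>- \<beta> - - A l\<bar> \<le> \<bar>- \<alpha> - - A l\<bar>) \<and> (\<exists>l\<ge>1. \<bar>- \<beta> - - A l\<bar> < \<bar>- \<alpha> - - A l\<bar>))"
    by (metis minus_minus)
  moreover have "\<bar>- x - - y\<bar> = \<bar>x - y\<bar>" for x y :: real by simp
  ultimately show ?thesis
    unfolding undominated_def by simp
qed

text \<open>Reflection reduces this to \<open>mono_optimum\<close>: \<open>- A\<close> is monotone
  with limit \<open>- L\<close>, distances are unchanged and the two endpoints trade places.\<close>

lemma antimono_optimum:
  fixes A :: "real \<Rightarrow> real"
  assumes anti: "antimono_on {1..} A"
  defines "L \<equiv> Lim at_top (\<lambda>l. ereal (A l))"
  shows "((\<lambda>l. ereal (A l)) \<longlongrightarrow> L) at_top"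
    and "undominated A \<alpha> \<longleftrightarrow> L \<le> ereal \<alpha> \<and> ereal \<alpha> \<le> ereal (A 1)"
    and "(a < b \<and> ereal b \<le> L) \<or> (ereal (A 1) \<le> ereal b \<and> b < a) \<Longrightarrow> 1 \<le> l \<Longrightarrow> \<bar>b - A l\<bar> \<le> \<bar>a - A l\<bar>"
proof -
  have mono: "mono_on {1..} (\<lambda>l. - A l)"
    using anti by (auto simp: monotone_on_def)
  define M where "M = Lim at_top (\<lambda>l. ereal (- A l))"
  note opt = mono_optimum[OF mono, folded M_def]
  have "((\<lambda>l. ereal (A l)) \<longlongrightarrow> - M) at_top"
    using tendsto_uminus_ereal[OF opt(1)] by simp
  moreover from this have L: "L = - M" unfolding L_def by (intro tendsto_Lim) auto
  ultimately show "((\<lambda>l. ereal (A l)) \<longlongrightarrow> L) at_top" by simp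
  show "undominated A \<alpha> \<longleftrightarrow> L \<le> ereal \<alpha> \<and> ereal \<alpha> \<le> ereal (A 1)"
    using opt(2)[of "- \<alpha>"] undominated_uminus[of A \<alpha>] L
    by (metis ereal_minus_le_minus ereal_uminus_uminus uminus_ereal.simps(1))
  show "\<bar>b - A l\<bar> \<le> \<bar>a - A l\<bar>"
    if "(a < b \<and> ereal b \<le> L) \<or> (ereal (A 1) \<le> ereal b \<and> b < a)" "1 \<le> l" for a b l
  proof -
    have "(- a < - b \<and> ereal (- b) \<le> ereal (- A 1)) \<or> (M \<le> ereal (- b) \<and> - b < - a)"
      using that(1) L by (metis ereal_minus_le_minus ereal_uminus_uminus uminus_ereal.simps(1) neg_less_iff_less)
    from opt(3)[OF this that(2)] show ?thesis by simp
  qed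
qed

section \<open>Changes of variables\<close>

text \<open>Coordinates \<open>s = x\<close>, \<open>z = y / x\<close> on the right half-plane.\<close>

lemma
  fixes F :: "real \<times> real \<Rightarrow> real"
  assumes int: "integrable lborel F" and supp: "\<And>x y. x \<le> 0 \<Longrightarrow> F (x, y) = 0"
  shows integrable_slope: "integrable lborel (\<lambda>z. LINT s:{0<..}|lborel. s * F (s, s * z))"
    and integral_slope: "(LINT p|lborel. F p) = (LINT z|lborel. (LINT s:{0<..}|lborel. s * F (s, s * z)))"
proof -
  have int': "integrable (lborel \<Otimes>\<^sub>M lborel) F" using int by (simp add: lborel_prod)
  have [measurable]: "F \<in> borel_measurable borel" using int by auto
  define H :: "real \<times> real \<Rightarrow> real" where
    "H = (\<lambda>(s, z). indicator {0<..} s *\<^sub>R (s * F (s, s * z)))"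
  have [measurable]: "H \<in> borel_measurable (lborel \<Otimes>\<^sub>M lborel)"
    unfolding H_def by simp
  \<comment> \<open>For \<open>0 < s\<close> this is the substitution \<open>y = s * z\<close> with
    Jacobian \<open>s\<close>; for other \<open>s\<close> both sides vanish, the right one by
    \<open>supp\<close>.\<close>
  have sec: "(LINT z|lborel. norm (H (s, z))) = (LINT y|lborel. norm (F (s, y)))"
    "(LINT z|lborel. H (s, z)) = (LINT y|lborel. F (s, y))" for s
    using lborel_integral_real_affine[of s "\<lambda>y. norm (F (s, y))" 0]
      lborel_integral_real_affine[of s "\<lambda>y. F (s, y)" 0] supp[of s]
    by (cases "0 < s"; simp add: H_def abs_mult)+
  \<comment> \<open>The iterated integrals of \<open>norm H\<close> agree with those of
    \<open>norm F\<close>, so integrability carries over.\<close>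
  have H: "integrable (lborel \<Otimes>\<^sub>M lborel) H"
  proof (rule lborel_pair.Fubini_integrable)
    show "integrable lborel (\<lambda>s. LINT z|lborel. norm (H (s, z)))"
      unfolding sec using lborel_pair.integrable_fst'[OF integrable_norm[OF int']] by simp
    show "AE s in lborel. integrable lborel (\<lambda>z. H (s, z))"
      using lborel_pair.AE_integrable_fst'[OF int']
    proof eventually_elim
      case (elim s)
      then show ?case
        using lborel_integrable_real_affine[OF elim, of s 0]
        by (cases "0 < s") (auto simp: H_def)
    qed
  qed simp
  have swap: "(\<lambda>z. LINT s:{0<..}|lborel. s * F (s, s * z)) = (\<lambda>z. LINT s|lborel. H (s, z))"
    by (simp add: H_def set_lebesgue_integral_def)
  show "integrable lborel (\<lambda>z. LINT s:{0<..}|lborel. s * F (s, s * z))"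
    unfolding swap using lborel_pair.integrable_snd[of "\<lambda>s z. H (s, z)"] H by simp
  have "(LINT p|lborel. F p) = (LINT p|(lborel \<Otimes>\<^sub>M lborel). F p)" by (simp add: lborel_prod)
  also have "\<dots> = (LINT s|lborel. LINT y|lborel. F (s, y))"
    using lborel_pair.integral_fst'[OF int'] by simp
  also have "\<dots> = (LINT s|lborel. LINT z|lborel. H (s, z))" by (simp add: sec)
  also have "\<dots> = (LINT z|lborel. LINT s|lborel. H (s, z))"
    using lborel_pair.Fubini_integral[of "\<lambda>s z. H (s, z)"] H by simp
  finally show "(LINT p|lborel. F p) = (LINT z|lborel. (LINT s:{0<..}|lborel. s * F (s, s * z)))"
    unfolding swap .
qed

text \<open>The Jacobian \<open>t1 * t2\<close> of the diagonal scaling cancels the normalising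
  factor in the density of \<open>law_X\<close>.\<close>

lemma integral_law_X:
  fixes h :: "real \<times> real \<Rightarrow> real"
  assumes [measurable]: "f \<in> borel_measurable borel" "h \<in> borel_measurable borel"
    and nonneg: "\<And>x. 0 \<le> f x" and pos: "0 < t1" "0 < t2"
  shows "(LINT x|law_X f (t1, t2). h x) = (LINT z|law_Z f. h (t1 * fst z, t2 * snd z))"
proof -
  \<comment> \<open>The two scale factors as a function on the basis
    \<open>{(1, 0), (0, 1)}\<close>, the form in which \<open>lborel_affine_euclidean\<close> takes
    them.\<close>
  define C :: "real \<times> real \<Rightarrow> real" where "C = (\<lambda>j. if j = (1, 0) then t1 else t2)"
  define T :: "real \<times> real \<Rightarrow> real \<times> real" where "T = (\<lambda>x. (t1 * fst x, t2 * snd x))"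
  have T: "(\<lambda>x. 0 + (\<Sum>j\<in>Basis. (C j * (x \<bullet> j)) *\<^sub>R j)) = T"
    by (auto simp: T_def C_def Basis_prod_def inner_prod_def fun_eq_iff
        sum.union_disjoint algebra_simps)
  have prodC: "(\<Prod>j\<in>Basis. \<bar>C j\<bar>) = t1 * t2"
    using pos by (auto simp: C_def Basis_prod_def)
  have [measurable]: "T \<in> borel_measurable borel"
    unfolding T_def by (intro borel_measurable_continuous_onI continuous_intros)
  have lb: "lborel = density (distr lborel borel T) (\<lambda>_. ennreal (t1 * t2))"
    using lborel_affine_euclidean[of C 0, unfolded T prodC] pos by (auto simp: C_def)
  define q where "q = (\<lambda>x. 1 / (t1 * t2) * f (fst x / t1, snd x / t2))"
  have [measurable]: "(\<lambda>x::real\<times>real. (fst x / t1, snd x / t2)) \<in> borel_measurable borel"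
    using pos by (intro borel_measurable_continuous_onI continuous_intros) auto
  have [measurable]: "q \<in> borel_measurable borel"
    unfolding q_def by measurable
  have "(LINT x|law_X f (t1, t2). h x) = (LINT x|lborel. q x * h x)"
    unfolding law_X_def fst_conv snd_conv q_def[symmetric]
    using nonneg pos by (subst integral_density) (auto simp: q_def)
  also have "\<dots> = (LINT x|lborel. t1 * t2 * (q (T x) * h (T x)))"
    using pos by (subst lb, subst integral_density) (auto simp: integral_distr)
  also have "\<dots> = (LINT x|lborel. f x * h (T x))"
    using pos by (intro Bochner_Integration.integral_cong) (auto simp: q_def T_def)
  also have "\<dots> = (LINT z|law_Z f. h (T z))"
    unfolding law_Z_def using nonneg by (subst integral_density) auto
  finally show ?thesis by (simp add: T_def)
qed

lemma abs_mult_le_half_sum_squares: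
  fixes a b :: real
  shows "\<bar>a * b\<bar> \<le> (a\<^sup>2 + b\<^sup>2) / 2"
  using sum_squares_bound[of "\<bar>a\<bar>" "\<bar>b\<bar>"] by (simp add: abs_mult)

section \<open>The model and its basic positivity facts\<close>

locale scale_model =
  fixes f :: "real \<times> real \<Rightarrow> real" and \<nu> :: real
  assumes f_meas [measurable]: "f \<in> borel_measurable borel"
    and f_nonneg: "\<And>x. 0 \<le> f x"
    and f_supp: "\<And>x1 x2. \<not> (0 < x1 \<and> 0 < x2) \<Longrightarrow> f (x1, x2) = 0"
    and f_prob: "(\<integral>\<^sup>+ x. ennreal (f x) \<partial>lborel) = 1"
    and moment1: "integrable (law_Z f) (\<lambda>z. (fst z)\<^sup>2)"
    and moment2: "integrable (law_Z f) (\<lambda>z. (snd z)\<^sup>2)"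
    and nu_pos: "0 < \<nu>"
    and f_Z_pos: "\<And>z. z \<in> {0<..<c01 f / \<nu>} \<Longrightarrow> 0 < f_Z f z"
    and psi_finite: "\<And>z r. z \<in> {0<..<c01 f / \<nu>} \<Longrightarrow> r \<in> {1, 2} \<Longrightarrow>
          set_integrable lborel {0<..} (\<lambda>s. s ^ (r + 1) * f (s, s * z))"
begin

lemma sets_law_Z [measurable_cong]: "sets (law_Z f) = sets borel"
  by (simp add: law_Z_def)

lemma prob_space_law_Z: "prob_space (law_Z f)"
  using f_prob by (intro prob_spaceI) (simp add: law_Z_def emeasure_density)

lemma AE_law_Z_pos: "AE z in law_Z f. 0 < fst z \<and> 0 < snd z"
proof -
  have "0 < fst z \<and> 0 < snd z" if "0 < f z" for z
    using f_supp[of "fst z" "snd z"] that by (cases z) auto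
  then show ?thesis
    unfolding law_Z_def by (subst AE_density) auto
qed

lemma integrable_fst_law_Z: "integrable (law_Z f) fst"
proof -
  interpret prob_space "law_Z f" by (rule prob_space_law_Z)
  show ?thesis
    by (rule square_integrable_imp_integrable) (use moment1 in simp_all)
qed

lemma c01_pos: "0 < c01 f"
proof -
  interpret prob_space "law_Z f" by (rule prob_space_law_Z)
  have "0 < (LINT z|law_Z f. fst z)"
    by (rule integral_less_AE_space[where X = "\<lambda>_. 0", simplified])
      (use integrable_fst_law_Z AE_law_Z_pos emeasure_space_1 in auto)
  moreover have "0 < (LINT z|law_Z f. (fst z)\<^sup>2)"
    by (rule integral_less_AE_space[where X = "\<lambda>_. 0", simplified])
      (use moment1 AE_law_Z_pos emeasure_space_1 in auto)
  ultimately show ?thesis by (simp add: c01_def)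
qed

text \<open>The estimators depart from \<open>c01 f * X1\<close> only where
  \<open>X2 / X1 < m\<close>, that is \<open>Z < m / l\<close> at ratio \<open>l\<close>.\<close>

abbreviation m :: real where "m \<equiv> c01 f / \<nu>"

lemma m_pos: "0 < m"
  using c01_pos nu_pos by simp

section \<open>Disintegration along \<open>Z\<close>\<close>

text \<open>Unnormalised conditional moments: \<open>G 0\<close> is \<open>f_Z\<close>, and
  \<open>G r\<close> is \<open>psi_r f r\<close> times \<open>f_Z\<close> wherever
  \<open>f_Z\<close> is nonzero. With them \<open>\<psi>\<close> is \<open>G 1 / G 2\<close> and the
  weight \<open>\<psi>\<^sub>2 f\<^sub>Z\<close> is \<open>G 2\<close>.\<close>

definition G :: "nat \<Rightarrow> real \<Rightarrow> real" where
  "G r z = (LINT s:{0<..}|lborel. s ^ (r + 1) * f (s, s * z))"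

lemma measurable_G [measurable]: "G r \<in> borel_measurable borel"
  unfolding G_def[abs_def] set_lebesgue_integral_def by measurable

lemma f_Z_eq: "f_Z f = G 0"
  by (simp add: f_Z_def G_def fun_eq_iff)

lemma psi_r_eq: "psi_r f r z = G r z / f_Z f z"
  by (simp add: psi_r_def G_def f_Z_def)

lemma measurable_psi [measurable]: "psi f \<in> borel_measurable borel"
  unfolding psi_def[abs_def] psi_r_eq f_Z_eq by measurable

lemma G_nonneg: "0 \<le> G r z"
  unfolding G_def set_lebesgue_integral_def
  using f_nonneg by (auto intro!: Bochner_Integration.integral_nonneg simp: indicator_def)

text \<open>If the integral of \<open>s ^ 3 * f (s, s * z)\<close> were 0, its nonnegative
  integrable integrand would vanish almost everywhere, and so would that of
  \<open>f_Z\<close>.\<close>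

lemma G2_pos:
  assumes "z \<in> {0<..<m}"
  shows "0 < G 2 z"
proof -
  have "G 2 z \<noteq> 0"
  proof
    assume "G 2 z = 0"
    then have "AE s in lborel. indicator {0<..} s *\<^sub>R (s ^ (2 + 1) * f (s, s * z)) = 0"
      unfolding G_def set_lebesgue_integral_def
      using psi_finite[OF assms, of 2] f_nonneg
      by (subst (asm) integral_nonneg_eq_0_iff_AE) (auto simp: set_integrable_def indicator_def)
    then have "AE s in lborel. indicator {0<..} s *\<^sub>R (s * f (s, s * z)) = 0"
      by eventually_elim (auto simp: indicator_def)
    then have "f_Z f z = 0"
      unfolding f_Z_def set_lebesgue_integral_def by (rule integral_eq_zero_AE)
    then show False using f_Z_pos[OF assms] by simp
  qed
  then show ?thesis using G_nonneg[of 2 z] by simp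
qed

lemma psi_eq:
  assumes "z \<in> {0<..<m}"
  shows "psi f z = G 1 z / G 2 z"
  using f_Z_pos[OF assms] by (simp add: psi_def psi_r_eq)

text \<open>Boundedness of \<open>\<phi>\<close> reduces integrability to the moments of
  \<open>Z1\<close>; slope coordinates then give the disintegration.\<close>

lemma
  fixes \<phi> :: "real \<Rightarrow> real"
  assumes [measurable]: "\<phi> \<in> borel_measurable borel" and bd: "\<And>z. \<bar>\<phi> z\<bar> \<le> B"
    and r: "r \<in> {1, 2}"
  shows integrable_law_slope: "integrable (law_Z f) (\<lambda>z. fst z ^ r * \<phi> (snd z / fst z))"
    and integrable_slope_moment: "integrable lborel (\<lambda>z. \<phi> z * G r z)"
    and slope_moment: "(LINT z|law_Z f. fst z ^ r * \<phi> (snd z / fst z)) = (LINT z|lborel. \<phi> z * G r z)"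
proof -
  have "integrable (law_Z f) (\<lambda>z. fst z ^ r)"
    using r moment1 integrable_fst_law_Z by auto
  then have "integrable (law_Z f) (\<lambda>z. B * fst z ^ r)" by simp
  then show int: "integrable (law_Z f) (\<lambda>z. fst z ^ r * \<phi> (snd z / fst z))"
  proof (rule Bochner_Integration.integrable_bound)
    have "\<bar>fst z ^ r * \<phi> (snd z / fst z)\<bar> \<le> \<bar>B * fst z ^ r\<bar>" for z
      using mult_mono[of "\<bar>\<phi> (snd z / fst z)\<bar>" "\<bar>B\<bar>" "\<bar>fst z ^ r\<bar>" "\<bar>fst z ^ r\<bar>"] bd[of "snd z / fst z"]
      by (simp add: abs_mult mult.commute)
    then show "AE z in law_Z f. norm (fst z ^ r * \<phi> (snd z / fst z)) \<le> norm (B * fst z ^ r)"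
      by simp
  qed measurable
  define F where "F = (\<lambda>z. f z * (fst z ^ r * \<phi> (snd z / fst z)))"
  have F: "integrable lborel F" "(LINT z|law_Z f. fst z ^ r * \<phi> (snd z / fst z)) = (LINT z|lborel. F z)"
    using int f_nonneg unfolding law_Z_def F_def by (simp_all add: integrable_density integral_density)
  have F0: "F (x, y) = 0" if "x \<le> 0" for x y
    using f_supp[of x y] that by (simp add: F_def)
  \<comment> \<open>The slope of \<open>(s, s * z)\<close> is \<open>z\<close> for every
    \<open>s > 0\<close>, so \<open>\<phi> z\<close> leaves the integral.\<close>
  have eq: "(LINT s:{0<..}|lborel. s * F (s, s * z)) = \<phi> z * G r z" for z
    unfolding G_def set_lebesgue_integral_def
    by (subst integral_mult_right_zero[symmetric], intro Bochner_Integration.integral_cong)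
      (auto simp: F_def indicator_def)
  show "integrable lborel (\<lambda>z. \<phi> z * G r z)"
    using integrable_slope[OF F(1) F0] by (simp add: eq)
  show "(LINT z|law_Z f. fst z ^ r * \<phi> (snd z / fst z)) = (LINT z|lborel. \<phi> z * G r z)"
    using F(2) integral_slope[OF F(1) F0] by (simp add: eq)
qed

text \<open>The substitution \<open>z = m * t / l\<close> turns the truncation interval into
  \<open>{0<..<1}\<close> for every \<open>l\<close> and the linear factor into
  \<open>c01 f * (1 - t)\<close>. The numerator of \<open>alpha1\<close> uses \<open>n = 1\<close>,
  the denominator \<open>n = 2\<close>.\<close>

lemma
  assumes l: "1 \<le> l" and r: "r \<in> {1, 2}"
  shows integrable_law_scaled: "integrable (law_Z f) (\<lambda>z. fst z ^ r * ((c01 f - \<nu> * l * (snd z / fst z)) ^ n *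
      indicator {0<..<c01 f / (l * \<nu>)} (snd z / fst z)))"
    and set_integrable_scaled: "set_integrable lborel {0<..<1} (\<lambda>t. (1 - t) ^ n * G r (m * t / l))"
    and set_integral_scaled: "(LINT z|law_Z f. fst z ^ r * ((c01 f - \<nu> * l * (snd z / fst z)) ^ n *
      indicator {0<..<c01 f / (l * \<nu>)} (snd z / fst z)))
      = m / l * c01 f ^ n * (LINT t:{0<..<1}|lborel. (1 - t) ^ n * G r (m * t / l))"
proof -
  define \<phi> :: "real \<Rightarrow> real" where
    "\<phi> = (\<lambda>z. (c01 f - \<nu> * l * z) ^ n * indicator {0<..<c01 f / (l * \<nu>)} z)"
  have [measurable]: "\<phi> \<in> borel_measurable borel" unfolding \<phi>_def by measurable
  have bd: "\<bar>\<phi> z\<bar> \<le> c01 f ^ n" for z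
    using c01_pos nu_pos l
    by (auto simp: \<phi>_def indicator_def power_abs[symmetric] field_simps intro!: power_mono)
  have ml: "m / l \<noteq> 0" "0 < m / l" using c01_pos nu_pos l by simp_all
  have eq: "\<phi> (m / l * t) * G r (m / l * t)
      = c01 f ^ n * (indicator {0<..<1} t *\<^sub>R ((1 - t) ^ n * G r (m * t / l)))" for t
  proof -
    have "m / l * t \<in> {0<..<c01 f / (l * \<nu>)} \<longleftrightarrow> t \<in> {0<..<1}"
    proof -
      have "c01 f / (l * \<nu>) = m / l * 1" by simp
      then have "m / l * t < c01 f / (l * \<nu>) \<longleftrightarrow> t < 1"
        using ml(2) by (simp only: mult_less_cancel_left_pos)
      moreover have "0 < m / l * t \<longleftrightarrow> 0 < t"
        using ml(2) by (simp only: zero_less_mult_iff) auto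
      ultimately show ?thesis by simp
    qed
    moreover have "c01 f - \<nu> * l * (m / l * t) = c01 f * (1 - t)"
      using nu_pos l by (simp add: field_simps)
    ultimately show ?thesis
      by (simp add: \<phi>_def indicator_def power_mult_distrib)
  qed
  show "integrable (law_Z f) (\<lambda>z. fst z ^ r * ((c01 f - \<nu> * l * (snd z / fst z)) ^ n *
      indicator {0<..<c01 f / (l * \<nu>)} (snd z / fst z)))"
    using integrable_law_slope[OF \<open>\<phi> \<in> borel_measurable borel\<close> bd r] unfolding \<phi>_def .
  note int = integrable_slope_moment[OF \<open>\<phi> \<in> borel_measurable borel\<close> bd r]
    and mom = slope_moment[OF \<open>\<phi> \<in> borel_measurable borel\<close> bd r]
  show "set_integrable lborel {0<..<1} (\<lambda>t. (1 - t) ^ n * G r (m * t / l))"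
    using lborel_integrable_real_affine[OF int ml(1), of 0] c01_pos
    unfolding set_integrable_def add_0 eq by (simp only: integrable_mult_left_iff) simp
  show "(LINT z|law_Z f. fst z ^ r * ((c01 f - \<nu> * l * (snd z / fst z)) ^ n *
      indicator {0<..<c01 f / (l * \<nu>)} (snd z / fst z)))
      = m / l * c01 f ^ n * (LINT t:{0<..<1}|lborel. (1 - t) ^ n * G r (m * t / l))"
    using mom lborel_integral_real_affine[OF ml(1), of "\<lambda>z. \<phi> z * G r z" 0] c01_pos nu_pos l
    unfolding set_lebesgue_integral_def add_0 eq by (simp add: \<phi>_def)
qed

section \<open>The weight and the integrals in \<open>alpha1\<close>\<close>

definition w :: "real \<Rightarrow> real \<Rightarrow> real" where
  "w l t = (1 - t)\<^sup>2 * G 2 (m * t / l)"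

definition W :: "real \<Rightarrow> real" where
  "W l = (LINT t:{0<..<1}|lborel. w l t)"

lemma scaled_in:
  assumes "1 \<le> l" "t \<in> {0<..<1}"
  shows "m * t / l \<in> {0<..<m}"
proof -
  have "m * t < m * 1" using assms m_pos by (intro mult_strict_left_mono) auto
  also have "\<dots> \<le> m * l" using assms m_pos by (intro mult_left_mono) auto
  finally show ?thesis using assms m_pos c01_pos nu_pos by (simp add: field_simps)
qed

lemma w_pos: "1 \<le> l \<Longrightarrow> t \<in> {0<..<1} \<Longrightarrow> 0 < w l t"
  using G2_pos[OF scaled_in] by (simp add: w_def)

lemma set_integrable_w: "1 \<le> l \<Longrightarrow> set_integrable lborel {0<..<1} (w l)"
  unfolding w_def by (rule set_integrable_scaled) auto

lemma W_pos:
  assumes "1 \<le> l"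
  shows "0 < W l"
proof -
  have nn: "0 \<le> indicator {0<..<1} t *\<^sub>R w l t" for t
    using w_pos[OF assms, of t] by (auto simp: indicator_def)
  have "W l \<noteq> 0"
  proof
    assume "W l = 0"
    then have "AE t in lborel. indicator {0<..<1} t *\<^sub>R w l t = 0"
      unfolding W_def set_lebesgue_integral_def
      using set_integrable_w[OF assms] nn
      by (subst (asm) integral_nonneg_eq_0_iff_AE) (auto simp: set_integrable_def)
    \<comment> \<open>The weight is strictly positive on the unit interval, so its vanishing almost
      everywhere would make that interval null.\<close>
    then have "AE t in lborel. t \<notin> {0<..<1::real}"
      by eventually_elim (use w_pos[OF assms] in \<open>force simp: indicator_def\<close>)
    then have "emeasure lborel {0<..<1::real} = 0"
      by (subst (asm) AE_iff_measurable[of "{0<..<1}"]) auto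
    then show False by simp
  qed
  moreover have "0 \<le> W l"
    unfolding W_def set_lebesgue_integral_def using nn by (rule Bochner_Integration.integral_nonneg)
  ultimately show ?thesis by simp
qed

lemma k1_scaled: "k1 f \<nu> t l = (psi f (m * t / l) - c01 f) / (1 - t)"
  by (simp add: k1_def field_simps)

text \<open>One factor \<open>1 - t\<close> of the weight cancels the pole of \<open>k1\<close>, and
  \<open>\<psi>\<close> times \<open>G 2\<close> is \<open>G 1\<close>; what remains is built from
  integrable pieces.\<close>

lemma k1_w:
  assumes "1 \<le> l" "t \<in> {0<..<1}"
  shows "k1 f \<nu> t l * w l t = (1 - t) * G 1 (m * t / l) - c01 f * ((1 - t) * G 2 (m * t / l))"
  using assms(2) psi_eq[OF scaled_in[OF assms]] G2_pos[OF scaled_in[OF assms]]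
  by (simp add: k1_scaled w_def power2_eq_square field_simps)

lemma
  assumes l: "1 \<le> l"
  shows set_integrable_k1_w: "set_integrable lborel {0<..<1} (\<lambda>t. k1 f \<nu> t l * w l t)"
    and set_integral_k1_w: "(LINT t:{0<..<1}|lborel. k1 f \<nu> t l * w l t) =
      (LINT t:{0<..<1}|lborel. (1 - t) * G 1 (m * t / l)) -
      c01 f * (LINT t:{0<..<1}|lborel. (1 - t) * G 2 (m * t / l))"
proof -
  have i: "set_integrable lborel {0<..<1} (\<lambda>t. (1 - t) * G r (m * t / l))" if "r \<in> {1, 2}" for r
    using set_integrable_scaled[OF l that, of 1] by simp
  show "set_integrable lborel {0<..<1} (\<lambda>t. k1 f \<nu> t l * w l t)"
    using i by (subst set_integrable_cong[OF refl refl k1_w[OF l]]) (auto intro!: set_integral_diff)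
  show "(LINT t:{0<..<1}|lborel. k1 f \<nu> t l * w l t) =
      (LINT t:{0<..<1}|lborel. (1 - t) * G 1 (m * t / l)) -
      c01 f * (LINT t:{0<..<1}|lborel. (1 - t) * G 2 (m * t / l))"
    using i by (subst set_lebesgue_integral_cong[where g = "\<lambda>t. (1 - t) * G 1 (m * t / l) - c01 f * ((1 - t) * G 2 (m * t / l))"])
      (auto simp: k1_w[OF l] set_integral_diff)
qed

text \<open>\<open>cross l\<close> and \<open>sq l\<close> are the integrands in the numerator and
  denominator of \<open>alpha1\<close>; they return as the coefficients of the loss expanded in
  \<open>\<alpha> - 1\<close>.\<close>

definition cross :: "real \<Rightarrow> real \<times> real \<Rightarrow> real" where
  "cross l z = (c01 f * fst z - \<nu> * l * snd z) * (1 - c01 f * fst z) *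
     indicator {0<..<c01 f / (l * \<nu>)} (snd z / fst z)"

definition sq :: "real \<Rightarrow> real \<times> real \<Rightarrow> real" where
  "sq l z = (c01 f * fst z - \<nu> * l * snd z)\<^sup>2 * indicator {0<..<c01 f / (l * \<nu>)} (snd z / fst z)"

lemma measurable_cross [measurable]: "cross l \<in> borel_measurable borel"
  unfolding cross_def[abs_def] by measurable

lemma measurable_sq [measurable]: "sq l \<in> borel_measurable borel"
  unfolding sq_def[abs_def] by measurable

text \<open>Almost surely \<open>Z1 > 0\<close>, so \<open>Z1\<close> factors out of the square and
  leaves a function of \<open>Z\<close> alone.\<close>

lemma integral_sq:
  assumes l: "1 \<le> l"
  shows "(LINT z|law_Z f. sq l z) = m / l * (c01 f)\<^sup>2 * W l"
proof -
  have "(LINT z|law_Z f. sq l z) = (LINT z|law_Z f. fst z ^ 2 * ((c01 f - \<nu> * l * (snd z / fst z)) ^ 2 *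
      indicator {0<..<c01 f / (l * \<nu>)} (snd z / fst z)))"
  proof (rule integral_cong_AE)
    show "AE z in law_Z f. sq l z = fst z ^ 2 * ((c01 f - \<nu> * l * (snd z / fst z)) ^ 2 *
      indicator {0<..<c01 f / (l * \<nu>)} (snd z / fst z))"
      using AE_law_Z_pos
    proof eventually_elim
      case (elim z)
      then have "fst z * (c01 f - \<nu> * l * (snd z / fst z)) = c01 f * fst z - \<nu> * l * snd z"
        by (simp add: field_simps)
      then show ?case by (simp add: sq_def power_mult_distrib[symmetric] mult.assoc[symmetric])
    qed
  qed measurable
  then show ?thesis
    using set_integral_scaled[OF l, of 2 2] by (simp add: W_def w_def)
qed

text \<open>Splitting \<open>1 - c01 f * Z1\<close> gives one term with first and one with second
  power of \<open>Z1\<close>, matching the two terms of \<open>k1_w\<close>.\<close>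

lemma integral_cross:
  assumes l: "1 \<le> l"
  shows "(LINT z|law_Z f. cross l z) = m / l * c01 f * (LINT t:{0<..<1}|lborel. k1 f \<nu> t l * w l t)"
proof -
  define \<phi> :: "nat \<Rightarrow> real \<times> real \<Rightarrow> real" where
    "\<phi> = (\<lambda>r z. fst z ^ r * ((c01 f - \<nu> * l * (snd z / fst z)) ^ 1 *
      indicator {0<..<c01 f / (l * \<nu>)} (snd z / fst z)))"
  have [measurable]: "\<phi> r \<in> borel_measurable borel" for r
    unfolding \<phi>_def by measurable
  have int: "integrable (law_Z f) (\<phi> r)" if "r \<in> {1, 2}" for r
    unfolding \<phi>_def by (rule integrable_law_scaled[OF l that])
  have "(LINT z|law_Z f. cross l z) = (LINT z|law_Z f. \<phi> 1 z - c01 f * \<phi> 2 z)"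
  proof (rule integral_cong_AE)
    show "AE z in law_Z f. cross l z = \<phi> 1 z - c01 f * \<phi> 2 z"
      using AE_law_Z_pos
    proof eventually_elim
      case (elim z)
      then have "c01 f * fst z - \<nu> * l * snd z = fst z * (c01 f - \<nu> * l * (snd z / fst z))"
        by (simp add: field_simps)
      then show ?case by (simp only: cross_def) (simp add: \<phi>_def power2_eq_square algebra_simps)
    qed
  qed measurable
  also have "\<dots> = (LINT z|law_Z f. \<phi> 1 z) - c01 f * (LINT z|law_Z f. \<phi> 2 z)"
    using int by simp
  finally have "(LINT z|law_Z f. cross l z) = (LINT z|law_Z f. \<phi> 1 z) - c01 f * (LINT z|law_Z f. \<phi> 2 z)" .
  moreover have "(LINT z|law_Z f. \<phi> r z) = m / l * c01 f ^ 1 *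
      (LINT t:{0<..<1}|lborel. (1 - t) ^ 1 * G r (m * t / l))" if "r \<in> {1, 2}" for r
    unfolding \<phi>_def by (rule set_integral_scaled[OF l that])
  from this[of 1] this[of 2]
  have "(LINT z|law_Z f. \<phi> 1 z) = m / l * c01 f * (LINT t:{0<..<1}|lborel. (1 - t) * G 1 (m * t / l))"
    "(LINT z|law_Z f. \<phi> 2 z) = m / l * c01 f * (LINT t:{0<..<1}|lborel. (1 - t) * G 2 (m * t / l))"
    by simp_all
  ultimately show ?thesis
    unfolding set_integral_k1_w[OF l] by (simp only: right_diff_distrib ac_simps)
qed

text \<open>In the quotient \<open>m / l\<close> cancels and one \<open>c01 f\<close> stays below,
  leaving the \<open>w l\<close>-average of \<open>k1\<close>.\<close>

lemma alpha1_eq: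
  assumes l: "1 \<le> l"
  shows "alpha1 f \<nu> l = 1 + (LINT t:{0<..<1}|lborel. k1 f \<nu> t l * w l t) / W l / c01 f"
proof -
  have "alpha1 f \<nu> l = 1 + (LINT z|law_Z f. cross l z) / (LINT z|law_Z f. sq l z)"
    by (simp add: alpha1_def cross_def sq_def)
  then show ?thesis
    using integral_cross[OF l] integral_sq[OF l] l c01_pos nu_pos W_pos[OF l]
    by (simp add: power2_eq_square)
qed

section \<open>Monotonicity of \<open>alpha1\<close>\<close>

text \<open>Monotonicity in \<open>\<lambda>\<close> passes through the average of \<open>k1 f \<nu> \<cdot> l\<close> against the weight
  \<open>w n\<close>. This mixed integral exists only because \<open>\<psi>\<close> is at most as large at scale \<open>l\<close> as at scale
  \<open>n\<close>, so in the case of increasing \<open>\<psi>\<close> the lemma is applied with \<open>l > n\<close>.\<close>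

lemma alpha1_le:
  assumes l: "1 \<le> l" and n: "1 \<le> n"
    and psi_le: "\<And>t. t \<in> {0<..<1} \<Longrightarrow> psi f (m * t / l) \<le> psi f (m * t / n)"
    and assoc: "\<And>s t. s \<in> {0<..<1} \<Longrightarrow> t \<in> {0<..<1} \<Longrightarrow>
      0 \<le> (k1 f \<nu> s l - k1 f \<nu> t l) * (w n s * w l t - w n t * w l s)"
  shows "alpha1 f \<nu> l \<le> alpha1 f \<nu> n"
proof -
  have k_le: "k1 f \<nu> t l \<le> k1 f \<nu> t n" if "t \<in> {0<..<1}" for t
    using psi_le[OF that] that by (simp add: k1_scaled divide_right_mono)
  have kw_le: "k1 f \<nu> t l * w n t \<le> k1 f \<nu> t n * w n t" if "t \<in> {0<..<1}" for t
    using k_le[OF that] w_pos[OF n that] by simp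
  \<comment> \<open>Since \<open>\<psi>\<close> is nonnegative, the mixed integrand has an
    integrable lower bound; \<open>kw_le\<close> bounds it above.\<close>
  have lower: "- c01 f * ((1 - t) * G 2 (m * t / n)) \<le> k1 f \<nu> t l * w n t" if "t \<in> {0<..<1}" for t
  proof -
    have "0 \<le> psi f (m * t / l)"
      unfolding psi_eq[OF scaled_in[OF l that]] by (simp add: G_nonneg)
    then have "- c01 f * ((1 - t) * G 2 (m * t / n)) \<le> (psi f (m * t / l) - c01 f) * ((1 - t) * G 2 (m * t / n))"
      using that G_nonneg by (intro mult_right_mono) auto
    also have "\<dots> = k1 f \<nu> t l * w n t"
      using that by (simp add: k1_scaled w_def power2_eq_square)
    finally show ?thesis .
  qed
  have mixed: "set_integrable lborel {0<..<1} (\<lambda>t. k1 f \<nu> t l * w n t)"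
  proof -
    have "set_integrable lborel {0<..<1} (\<lambda>t. \<bar>k1 f \<nu> t n * w n t\<bar> + c01 f * ((1 - t) * G 2 (m * t / n)))"
      using set_integrable_k1_w[OF n] set_integrable_scaled[OF n, of 2 1]
      by (auto intro!: set_integral_add set_integrable_abs)
    then show ?thesis
    proof (rule set_integrable_bound)
      show "set_borel_measurable lborel {0<..<1} (\<lambda>t. k1 f \<nu> t l * w n t)"
        unfolding set_borel_measurable_def k1_def w_def by measurable
      have "\<bar>k1 f \<nu> t l * w n t\<bar> \<le> \<bar>k1 f \<nu> t n * w n t\<bar> + c01 f * ((1 - t) * G 2 (m * t / n))"
        if t: "t \<in> {0<..<1}" for t
      proof -
        have "0 \<le> c01 f * ((1 - t) * G 2 (m * t / n))"
          using t c01_pos G_nonneg by simp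
        then show ?thesis using lower[OF t] kw_le[OF t] by linarith
      qed
      then show "AE t in lborel. t \<in> {0<..<1} \<longrightarrow> norm (k1 f \<nu> t l * w n t) \<le>
          norm (\<bar>k1 f \<nu> t n * w n t\<bar> + c01 f * ((1 - t) * G 2 (m * t / n)))"
        by (intro AE_I2) (force simp: abs_real_def)
    qed
  qed
  \<comment> \<open>First the weight moves from scale \<open>l\<close> to \<open>n\<close> with
    \<open>k1\<close> held fixed; then \<open>k1\<close> itself moves, by
    \<open>psi_le\<close>.\<close>
  have "(LINT t:{0<..<1}|lborel. k1 f \<nu> t l * w l t) * W n \<le> (LINT t:{0<..<1}|lborel. k1 f \<nu> t l * w n t) * W l"
    unfolding W_def
    by (rule set_integral_correlation)
      (use set_integrable_w l n set_integrable_k1_w mixed assoc in auto)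
  also have "\<dots> \<le> (LINT t:{0<..<1}|lborel. k1 f \<nu> t n * w n t) * W l"
    using W_pos[OF l]
    by (intro mult_right_mono set_integral_mono mixed set_integrable_k1_w n kw_le) auto
  finally have "(LINT t:{0<..<1}|lborel. k1 f \<nu> t l * w l t) / W l \<le> (LINT t:{0<..<1}|lborel. k1 f \<nu> t n * w n t) / W n"
    using W_pos l n by (simp add: field_simps)
  then show ?thesis
    unfolding alpha1_eq[OF l] alpha1_eq[OF n]
    using c01_pos by (intro add_left_mono divide_right_mono) auto
qed

text \<open>At \<open>u\<close> the quotient of \<open>w n\<close> by \<open>w l\<close> is
  \<open>\<rho> (m * u / l)\<close>: the factor \<open>(1 - u)\<^sup>2\<close> cancels and
  \<open>m * u / n\<close> is \<open>l / n\<close> times \<open>m * u / l\<close>.\<close>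

lemma w_ratio:
  assumes "1 \<le> l" "l < n" "s \<in> {0<..<1}" "t \<in> {0<..<1}"
  defines "\<rho> \<equiv> \<lambda>t. psi_r f 2 (l / n * t) / psi_r f 2 t * (f_Z f (l / n * t) / f_Z f t)"
  shows "w n s * w l t - w n t * w l s = w l s * w l t * (\<rho> (m * s / l) - \<rho> (m * t / l))"
proof -
  have *: "w n u = w l u * \<rho> (m * u / l)" if u: "u \<in> {0<..<1}" for u
  proof -
    have "l / n * (m * u / l) = m * u / n" using assms(1,2) by simp
    then show ?thesis
      using f_Z_pos[OF scaled_in[OF assms(1) u]] f_Z_pos[OF scaled_in[of n u]] G2_pos[OF scaled_in[OF assms(1) u]] assms(1,2) u
      by (simp add: \<rho>_def psi_r_eq w_def)
  qed
  show ?thesis by (simp add: *[OF assms(3)] *[OF assms(4)] algebra_simps)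
qed

text \<open>The sign \<open>\<sigma> = -1\<close> serves the case where \<open>k1\<close> and the two ratios vary in opposite directions.\<close>

lemma k1_w_association:
  assumes ln: "1 \<le> l" "l < n"
    and cond: "((\<forall>\<theta>\<in>{0<..<1}. mono_on {0<..<m} (\<lambda>t. psi_r f 2 (\<theta> * t) / psi_r f 2 t) \<and>
                       mono_on {0<..<m} (\<lambda>t. f_Z f (\<theta> * t) / f_Z f t)) \<and>
        mono_on {0<..<1} (\<lambda>z. \<sigma> * k1 f \<nu> z l'))
       \<or> ((\<forall>\<theta>\<in>{0<..<1}. antimono_on {0<..<m} (\<lambda>t. psi_r f 2 (\<theta> * t) / psi_r f 2 t) \<and>
                       antimono_on {0<..<m} (\<lambda>t. f_Z f (\<theta> * t) / f_Z f t)) \<and>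
        antimono_on {0<..<1} (\<lambda>z. \<sigma> * k1 f \<nu> z l'))"
    and st: "s \<in> {0<..<1}" "t \<in> {0<..<1}"
  shows "0 \<le> \<sigma> * ((k1 f \<nu> s l' - k1 f \<nu> t l') * (w n s * w l t - w n t * w l s))"
proof -
  \<comment> \<open>Exchanging \<open>s\<close> and \<open>t\<close> flips the sign of both factors,
    so one order of the two points suffices.\<close>
  have ordered: "0 \<le> \<sigma> * ((k1 f \<nu> s l' - k1 f \<nu> t l') * (w n s * w l t - w n t * w l s))"
    if st: "s \<in> {0<..<1}" "t \<in> {0<..<1}" and "s \<le> t" for s t
  proof -
    define \<rho>1 where "\<rho>1 = (\<lambda>t. psi_r f 2 (l / n * t) / psi_r f 2 t)"
    define \<rho>2 where "\<rho>2 = (\<lambda>t. f_Z f (l / n * t) / f_Z f t)"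
    define u where "u = m * s / l"
    define v where "v = m * t / l"
    have uv: "u \<in> {0<..<m}" "v \<in> {0<..<m}"
      unfolding u_def v_def using scaled_in ln st by blast+
    have "u \<le> v" unfolding u_def v_def
      using \<open>s \<le> t\<close> m_pos ln by (intro divide_right_mono mult_left_mono) auto
    have \<theta>: "l / n \<in> {0<..<1}" using ln by simp
    have nn: "0 \<le> \<rho>1 u" "0 \<le> \<rho>1 v" "0 \<le> \<rho>2 u" "0 \<le> \<rho>2 v"
      unfolding \<rho>1_def \<rho>2_def by (simp_all add: psi_r_eq f_Z_eq G_nonneg)
    have "(\<rho>1 u \<le> \<rho>1 v \<and> \<rho>2 u \<le> \<rho>2 v \<and> \<sigma> * k1 f \<nu> s l' \<le> \<sigma> * k1 f \<nu> t l') \<or>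
      (\<rho>1 v \<le> \<rho>1 u \<and> \<rho>2 v \<le> \<rho>2 u \<and> \<sigma> * k1 f \<nu> t l' \<le> \<sigma> * k1 f \<nu> s l')"
      using cond
    proof
      assume *: "(\<forall>\<theta>\<in>{0<..<1}. mono_on {0<..<m} (\<lambda>t. psi_r f 2 (\<theta> * t) / psi_r f 2 t) \<and>
                       mono_on {0<..<m} (\<lambda>t. f_Z f (\<theta> * t) / f_Z f t)) \<and>
        mono_on {0<..<1} (\<lambda>z. \<sigma> * k1 f \<nu> z l')"
      then have "mono_on {0<..<m} \<rho>1" "mono_on {0<..<m} \<rho>2"
        unfolding \<rho>1_def \<rho>2_def using \<theta> by blast+
      then show ?thesis
        using * uv \<open>u \<le> v\<close> st \<open>s \<le> t\<close> by (blast dest: monotone_onD)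
    next
      assume *: "(\<forall>\<theta>\<in>{0<..<1}. antimono_on {0<..<m} (\<lambda>t. psi_r f 2 (\<theta> * t) / psi_r f 2 t) \<and>
                       antimono_on {0<..<m} (\<lambda>t. f_Z f (\<theta> * t) / f_Z f t)) \<and>
        antimono_on {0<..<1} (\<lambda>z. \<sigma> * k1 f \<nu> z l')"
      then have "antimono_on {0<..<m} \<rho>1" "antimono_on {0<..<m} \<rho>2"
        unfolding \<rho>1_def \<rho>2_def using \<theta> by blast+
      then show ?thesis
        using * uv \<open>u \<le> v\<close> st \<open>s \<le> t\<close> by (blast dest: monotone_onD)
    qed
    \<comment> \<open>Because the two ratios are nonnegative and vary in the same direction, so does
      their product.\<close>
    then have "0 \<le> (\<sigma> * k1 f \<nu> s l' - \<sigma> * k1 f \<nu> t l') * (\<rho>1 u * \<rho>2 u - \<rho>1 v * \<rho>2 v)"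
      using mult_mono[of "\<rho>1 u" "\<rho>1 v" "\<rho>2 u" "\<rho>2 v"] mult_mono[of "\<rho>1 v" "\<rho>1 u" "\<rho>2 v" "\<rho>2 u"] nn
      by (auto simp: zero_le_mult_iff)
    then have "0 \<le> (w l s * w l t) * ((\<sigma> * k1 f \<nu> s l' - \<sigma> * k1 f \<nu> t l') * (\<rho>1 u * \<rho>2 u - \<rho>1 v * \<rho>2 v))"
      using w_pos[OF ln(1) st(1)] w_pos[OF ln(1) st(2)]
      by (intro mult_nonneg_nonneg[of "w l s * w l t"]) simp_all
    also have "\<dots> = \<sigma> * ((k1 f \<nu> s l' - k1 f \<nu> t l') * (w n s * w l t - w n t * w l s))"
      unfolding w_ratio[OF ln st] \<rho>1_def \<rho>2_def u_def v_def by (simp add: algebra_simps)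
    finally show ?thesis .
  qed
  show ?thesis
    using ordered[OF st] ordered[OF st(2,1)] by (cases "s \<le> t") (auto simp: algebra_simps)
qed

lemma psi_scaled_le:
  assumes "1 \<le> l" "l < n" "t \<in> {0<..<1}"
  shows "antimono_on {0<..<m} (psi f) \<Longrightarrow> psi f (m * t / l) \<le> psi f (m * t / n)"
    and "mono_on {0<..<m} (psi f) \<Longrightarrow> psi f (m * t / n) \<le> psi f (m * t / l)"
proof -
  have "m * t / n \<le> m * t / l"
    using assms c01_pos nu_pos by (intro divide_left_mono mult_nonneg_nonneg) auto
  moreover have "m * t / n \<in> {0<..<m}" "m * t / l \<in> {0<..<m}"
    by (rule scaled_in; use assms in simp)+
  ultimately show "antimono_on {0<..<m} (psi f) \<Longrightarrow> psi f (m * t / l) \<le> psi f (m * t / n)"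
    and "mono_on {0<..<m} (psi f) \<Longrightarrow> psi f (m * t / n) \<le> psi f (m * t / l)"
    by (auto dest: monotone_onD simp del: greaterThanLessThan_iff)
qed

lemma mono_alpha1:
  assumes psi: "antimono_on {0<..<m} (psi f)"
    and cond: "(\<forall>\<theta>\<in>{0<..<1}. mono_on {0<..<m} (\<lambda>t. psi_r f 2 (\<theta> * t) / psi_r f 2 t) \<and>
                       mono_on {0<..<m} (\<lambda>t. f_Z f (\<theta> * t) / f_Z f t)) \<and>
       (\<forall>l\<ge>1. mono_on {0<..<1} (\<lambda>z. k1 f \<nu> z l))
       \<or>
       (\<forall>\<theta>\<in>{0<..<1}. antimono_on {0<..<m} (\<lambda>t. psi_r f 2 (\<theta> * t) / psi_r f 2 t) \<and>
                       antimono_on {0<..<m} (\<lambda>t. f_Z f (\<theta> * t) / f_Z f t)) \<and>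
       (\<forall>l\<ge>1. antimono_on {0<..<1} (\<lambda>z. k1 f \<nu> z l))"
  shows "mono_on {1..} (alpha1 f \<nu>)"
proof (rule mono_onI)
  fix l n :: real assume "l \<in> {1..}" "n \<in> {1..}" "l \<le> n"
  then consider "l = n" | "1 \<le> l" "l < n" by fastforce
  then show "alpha1 f \<nu> l \<le> alpha1 f \<nu> n"
  proof cases
    case 2
    show ?thesis
    proof (rule alpha1_le)
      show "0 \<le> (k1 f \<nu> s l - k1 f \<nu> t l) * (w n s * w l t - w n t * w l s)"
        if "s \<in> {0<..<1}" "t \<in> {0<..<1}" for s t
        using k1_w_association[OF 2 _ that, where \<sigma> = 1 and l' = l] cond 2(1) by (simp only: mult_1_left) blast
    qed (use 2 psi_scaled_le psi in auto)
  qed simp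
qed

text \<open>\<open>alpha1_le\<close> is used with the scales exchanged: \<open>k1\<close> is held at
  the larger scale \<open>n\<close> while the weight passes from \<open>w n\<close> to
  \<open>w l\<close>. The exchange reverses the sign of the weight bracket, which
  \<open>\<sigma> = -1\<close> absorbs.\<close>

lemma antimono_alpha1:
  assumes psi: "mono_on {0<..<m} (psi f)"
    and cond: "(\<forall>\<theta>\<in>{0<..<1}. mono_on {0<..<m} (\<lambda>t. psi_r f 2 (\<theta> * t) / psi_r f 2 t) \<and>
                       mono_on {0<..<m} (\<lambda>t. f_Z f (\<theta> * t) / f_Z f t)) \<and>
       (\<forall>l\<ge>1. antimono_on {0<..<1} (\<lambda>z. k1 f \<nu> z l))
       \<or>
       (\<forall>\<theta>\<in>{0<..<1}. antimono_on {0<..<m} (\<lambda>t. psi_r f 2 (\<theta> * t) / psi_r f 2 t) \<and>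
                       antimono_on {0<..<m} (\<lambda>t. f_Z f (\<theta> * t) / f_Z f t)) \<and>
       (\<forall>l\<ge>1. mono_on {0<..<1} (\<lambda>z. k1 f \<nu> z l))"
  shows "antimono_on {1..} (alpha1 f \<nu>)"
proof (rule monotone_onI)
  fix l n :: real assume "l \<in> {1..}" "n \<in> {1..}" "l \<le> n"
  then consider "l = n" | "1 \<le> l" "l < n" by fastforce
  then show "alpha1 f \<nu> n \<le> alpha1 f \<nu> l"
  proof cases
    case 2
    show ?thesis
    proof (rule alpha1_le)
      have "(\<forall>\<theta>\<in>{0<..<1}. mono_on {0<..<m} (\<lambda>t. psi_r f 2 (\<theta> * t) / psi_r f 2 t) \<and>
                       mono_on {0<..<m} (\<lambda>t. f_Z f (\<theta> * t) / f_Z f t)) \<and>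
          mono_on {0<..<1} (\<lambda>z. - 1 * k1 f \<nu> z n)
        \<or> (\<forall>\<theta>\<in>{0<..<1}. antimono_on {0<..<m} (\<lambda>t. psi_r f 2 (\<theta> * t) / psi_r f 2 t) \<and>
                       antimono_on {0<..<m} (\<lambda>t. f_Z f (\<theta> * t) / f_Z f t)) \<and>
          antimono_on {0<..<1} (\<lambda>z. - 1 * k1 f \<nu> z n)"
        using cond
      proof (elim disjE)
        assume "(\<forall>\<theta>\<in>{0<..<1}. mono_on {0<..<m} (\<lambda>t. psi_r f 2 (\<theta> * t) / psi_r f 2 t) \<and>
                       mono_on {0<..<m} (\<lambda>t. f_Z f (\<theta> * t) / f_Z f t)) \<and>
          (\<forall>l\<ge>1. antimono_on {0<..<1} (\<lambda>z. k1 f \<nu> z l))"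
        moreover from this have "mono_on {0<..<1} (\<lambda>z. - 1 * k1 f \<nu> z n)"
          using 2 unfolding monotone_on_def by simp
        ultimately show ?thesis by blast
      next
        assume "(\<forall>\<theta>\<in>{0<..<1}. antimono_on {0<..<m} (\<lambda>t. psi_r f 2 (\<theta> * t) / psi_r f 2 t) \<and>
                       antimono_on {0<..<m} (\<lambda>t. f_Z f (\<theta> * t) / f_Z f t)) \<and>
          (\<forall>l\<ge>1. mono_on {0<..<1} (\<lambda>z. k1 f \<nu> z l))"
        moreover from this have "antimono_on {0<..<1} (\<lambda>z. - 1 * k1 f \<nu> z n)"
          using 2 unfolding monotone_on_def by simp
        ultimately show ?thesis by blast
      qed
      from k1_w_association[OF 2 this]
      show "0 \<le> (k1 f \<nu> s n - k1 f \<nu> t n) * (w l s * w n t - w l t * w n s)"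
        if "s \<in> {0<..<1}" "t \<in> {0<..<1}" for s t
        using that by (simp add: algebra_simps)
    qed (use 2 psi_scaled_le psi in auto)
  qed simp
qed

section \<open>The risk as a quadratic in the parameter\<close>

text \<open>The constant risk of \<open>delta f \<nu> 1\<close>, the unrestricted estimator
  \<open>c01 f * X1\<close>, about which the risk is expanded.\<close>

definition base_risk :: real where
  "base_risk = (LINT z|law_Z f. (c01 f * fst z - 1)\<^sup>2)"

text \<open>On the truncation event the scaled error is that of \<open>c01 f * X1\<close> plus
  \<open>\<alpha> - 1\<close> times a linear form in \<open>z\<close>; elsewhere the two errors
  agree.\<close>

lemma delta_scaled:
  assumes "0 < t1" "t1 \<le> t2" and z: "0 < fst z" "0 < snd z"
  shows "(delta f \<nu> \<alpha> (t1 * fst z, t2 * snd z) / t1 - 1)\<^sup>2 =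
    (c01 f * fst z - 1)\<^sup>2 + (\<alpha> - 1)\<^sup>2 * sq (t2 / t1) z - 2 * (\<alpha> - 1) * cross (t2 / t1) z"
proof -
  have ind: "snd z / fst z \<in> {0<..<c01 f / (t2 / t1 * \<nu>)} \<longleftrightarrow> \<not> c01 f * (t1 * fst z) \<le> \<nu> * (t2 * snd z)"
    using assms nu_pos by (simp add: field_simps not_le)
  show ?thesis
  proof (cases "c01 f * (t1 * fst z) \<le> \<nu> * (t2 * snd z)")
    case True
    then show ?thesis using assms ind by (simp add: delta_def sq_def cross_def)
  next
    case False
    have "delta f \<nu> \<alpha> (t1 * fst z, t2 * snd z) / t1 - 1 =
        (c01 f * fst z - 1) + (\<alpha> - 1) * (c01 f * fst z - \<nu> * (t2 / t1) * snd z)"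
      using False assms by (simp add: delta_def field_simps)
    moreover have "indicator {0<..<c01 f / (t2 / t1 * \<nu>)} (snd z / fst z) = (1::real)"
      using ind False by (simp only: indicator_def) simp
    moreover have "(x + (\<alpha> - 1) * y)\<^sup>2 = x\<^sup>2 + (\<alpha> - 1)\<^sup>2 * (y\<^sup>2 * 1) - 2 * (\<alpha> - 1) * (y * - x * 1)" for x y :: real
      by (simp add: power2_eq_square algebra_simps)
    ultimately show ?thesis
      unfolding sq_def cross_def by (simp only: minus_diff_eq[symmetric, of 1])
  qed
qed

lemma integrable_terms:
  shows
  "integrable (law_Z f) (\<lambda>z. (c01 f * fst z - 1)\<^sup>2)"
    and "integrable (law_Z f) (sq l)" and "integrable (law_Z f) (cross l)"
proof -
  interpret prob_space "law_Z f" by (rule prob_space_law_Z)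
  show 1: "integrable (law_Z f) (\<lambda>z. (c01 f * fst z - 1)\<^sup>2)"
    using moment1 integrable_fst_law_Z by (simp add: power2_diff power_mult_distrib)
  have dom: "integrable (law_Z f) (\<lambda>z. 2 * (c01 f)\<^sup>2 * (fst z)\<^sup>2 + 2 * (\<nu> * l)\<^sup>2 * (snd z)\<^sup>2)"
    using moment1 moment2 by simp
  have bd: "(a - b)\<^sup>2 \<le> 2 * a\<^sup>2 + 2 * b\<^sup>2" for a b :: real
    using zero_le_power2[of "a + b"] by (simp add: power2_sum power2_diff)
  have sqb: "(c01 f * fst z - \<nu> * l * snd z)\<^sup>2 \<le> 2 * (c01 f)\<^sup>2 * (fst z)\<^sup>2 + 2 * (\<nu> * l)\<^sup>2 * (snd z)\<^sup>2" for z :: "real \<times> real"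
    using bd[of "c01 f * fst z" "\<nu> * l * snd z"] by (simp add: power_mult_distrib)
  show 2: "integrable (law_Z f) (sq l)"
    using dom
  proof (rule Bochner_Integration.integrable_bound)
    show "AE z in law_Z f. norm (sq l z) \<le> norm (2 * (c01 f)\<^sup>2 * (fst z)\<^sup>2 + 2 * (\<nu> * l)\<^sup>2 * (snd z)\<^sup>2)"
      using sqb by (intro AE_I2) (auto simp: sq_def indicator_def)
  qed measurable
  show "integrable (law_Z f) (cross l)"
  proof (rule Bochner_Integration.integrable_bound)
    show "integrable (law_Z f) (\<lambda>z. (c01 f * fst z - 1)\<^sup>2 + sq l z)"
      using 1 2 by simp
    have "\<bar>cross l z\<bar> \<le> (c01 f * fst z - 1)\<^sup>2 + sq l z" for z
    proof -
      have "\<bar>(c01 f * fst z - \<nu> * l * snd z) * (1 - c01 f * fst z)\<bar> \<le>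
          (c01 f * fst z - 1)\<^sup>2 + (c01 f * fst z - \<nu> * l * snd z)\<^sup>2"
        using abs_mult_le_half_sum_squares[of "c01 f * fst z - \<nu> * l * snd z" "1 - c01 f * fst z"]
          zero_le_power2[of "c01 f * fst z - 1"] zero_le_power2[of "c01 f * fst z - \<nu> * l * snd z"]
        unfolding power2_commute[of 1] by argo
      then show ?thesis by (simp add: cross_def sq_def indicator_def)
    qed
    then show "AE z in law_Z f. norm (cross l z) \<le> norm ((c01 f * fst z - 1)\<^sup>2 + sq l z)"
      by (intro AE_I2) (simp add: order_trans[OF _ abs_ge_self])
  qed measurable
qed

text \<open>Completing the square in \<open>\<alpha> - 1\<close>: \<open>alpha1 - 1\<close> is the
  linear coefficient \<open>cross\<close> over the quadratic one \<open>sq\<close>, both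
  integrated.\<close>

lemma R1_delta:
  assumes "0 < t1" "t1 \<le> t2"
  shows "R1 f (t1, t2) (delta f \<nu> \<alpha>) = base_risk + (LINT z|law_Z f. sq (t2 / t1) z) *
    ((\<alpha> - alpha1 f \<nu> (t2 / t1))\<^sup>2 - (1 - alpha1 f \<nu> (t2 / t1))\<^sup>2)"
proof -
  let ?l = "t2 / t1"
  have l: "1 \<le> ?l" using assms by simp
  have [measurable]: "delta f \<nu> \<alpha> \<in> borel_measurable borel"
    unfolding delta_def[abs_def] by measurable
  have [measurable]: "(\<lambda>z::real \<times> real. (t1 * fst z, t2 * snd z)) \<in> borel_measurable borel"
    by (intro borel_measurable_continuous_onI continuous_intros)
  have "R1 f (t1, t2) (delta f \<nu> \<alpha>) =
      (LINT z|law_Z f. (delta f \<nu> \<alpha> (t1 * fst z, t2 * snd z) / t1 - 1)\<^sup>2)"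
    unfolding R1_def using assms f_nonneg by (subst integral_law_X) auto
  also have "\<dots> = (LINT z|law_Z f. (c01 f * fst z - 1)\<^sup>2 + (\<alpha> - 1)\<^sup>2 * sq ?l z - 2 * (\<alpha> - 1) * cross ?l z)"
    by (rule integral_cong_AE) (use AE_law_Z_pos delta_scaled[OF assms] in auto)
  also have "\<dots> = base_risk + (\<alpha> - 1)\<^sup>2 * (LINT z|law_Z f. sq ?l z) - 2 * (\<alpha> - 1) * (LINT z|law_Z f. cross ?l z)"
    using integrable_terms by (simp add: base_risk_def)
  also have "(LINT z|law_Z f. cross ?l z) = (LINT z|law_Z f. sq ?l z) * (alpha1 f \<nu> ?l - 1)"
  proof -
    have "(LINT z|law_Z f. sq ?l z) \<noteq> 0"
      using integral_sq[OF l] W_pos[OF l] c01_pos nu_pos assms by simp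
    moreover have "alpha1 f \<nu> ?l = 1 + (LINT z|law_Z f. cross ?l z) / (LINT z|law_Z f. sq ?l z)"
      unfolding alpha1_def cross_def sq_def ..
    ultimately show ?thesis by (simp only: add_diff_cancel_left' times_divide_eq_right nonzero_mult_div_cancel_left not_False_eq_True)
  qed
  finally show ?thesis by (simp add: power2_eq_square algebra_simps)
qed

lemma R1_delta_le_iff:
  assumes "0 < t1" "t1 \<le> t2"
  shows "R1 f (t1, t2) (delta f \<nu> \<beta>) \<le> R1 f (t1, t2) (delta f \<nu> \<alpha>) \<longleftrightarrow>
    \<bar>\<beta> - alpha1 f \<nu> (t2 / t1)\<bar> \<le> \<bar>\<alpha> - alpha1 f \<nu> (t2 / t1)\<bar>"
proof -
  have l: "1 \<le> t2 / t1" using assms by simp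
  have "0 < (LINT z|law_Z f. sq (t2 / t1) z)"
    using integral_sq[OF l] W_pos[OF l] c01_pos nu_pos assms by simp
  then show ?thesis by (simp add: R1_delta[OF assms] abs_le_square_iff)
qed

section \<open>From risks to admissibility\<close>

text \<open>Risk comparisons depend on the parameter only through \<open>t2 / t1\<close>, and
  \<open>(1, l)\<close> realises every ratio \<open>l \<ge> 1\<close>.\<close>

lemma Theta0_iff_ratio:
  "(\<forall>\<theta>\<in>Theta0. R1 f \<theta> (delta f \<nu> \<beta>) \<le> R1 f \<theta> (delta f \<nu> \<alpha>)) \<longleftrightarrow>
    (\<forall>l\<ge>1. \<bar>\<beta> - alpha1 f \<nu> l\<bar> \<le> \<bar>\<alpha> - alpha1 f \<nu> l\<bar>)" (is "?L \<longleftrightarrow> ?R")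
proof
  assume L: ?L
  show ?R
  proof safe
    fix l :: real assume "1 \<le> l"
    then have "(1, l) \<in> Theta0" by (simp add: Theta0_def)
    then show "\<bar>\<beta> - alpha1 f \<nu> l\<bar> \<le> \<bar>\<alpha> - alpha1 f \<nu> l\<bar>"
      using L R1_delta_le_iff[of 1 l] \<open>1 \<le> l\<close> by force
  qed
next
  assume ?R
  then show ?L by (auto simp: Theta0_def R1_delta_le_iff)
qed

text \<open>Strict improvement somewhere is the failure of the reverse weak domination, so
  \<open>Theta0_iff_ratio\<close> translates both halves of the definition.\<close>

lemma admissible_delta_iff:
  "admissible_within f (D1 f \<nu>) (delta f \<nu> \<alpha>) \<longleftrightarrow> undominated (alpha1 f \<nu>) \<alpha>"
proof -
  have "(\<forall>\<theta>\<in>Theta0. R1 f \<theta> d' \<le> R1 f \<theta> d) \<and> (\<exists>\<theta>\<in>Theta0. R1 f \<theta> d' < R1 f \<theta> d) \<longleftrightarrow>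
    (\<forall>\<theta>\<in>Theta0. R1 f \<theta> d' \<le> R1 f \<theta> d) \<and> \<not> (\<forall>\<theta>\<in>Theta0. R1 f \<theta> d \<le> R1 f \<theta> d')" for d d'
    by (auto simp: not_le)
  moreover have "undominated (alpha1 f \<nu>) \<alpha> \<longleftrightarrow> \<not> (\<exists>\<beta>. (\<forall>l\<ge>1. \<bar>\<beta> - alpha1 f \<nu> l\<bar> \<le> \<bar>\<alpha> - alpha1 f \<nu> l\<bar>) \<and>
      \<not> (\<forall>l\<ge>1. \<bar>\<alpha> - alpha1 f \<nu> l\<bar> \<le> \<bar>\<beta> - alpha1 f \<nu> l\<bar>))"
    unfolding undominated_def by (metis not_le)
  ultimately show ?thesis
    by (simp add: admissible_within_def D1_def Theta0_iff_ratio)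
qed

lemma admissible_set_eq:
  assumes "\<And>\<alpha>. undominated (alpha1 f \<nu>) \<alpha> \<longleftrightarrow> P \<alpha>"
  shows "{\<delta>. admissible_within f (D1 f \<nu>) \<delta>} = {delta f \<nu> \<alpha> |\<alpha>. P \<alpha>}"
proof -
  have "admissible_within f (D1 f \<nu>) \<delta> \<Longrightarrow> \<exists>\<alpha>. \<delta> = delta f \<nu> \<alpha>" for \<delta>
    by (auto simp: admissible_within_def D1_def)
  then show ?thesis using admissible_delta_iff assms by blast
qed

end

section \<open>Admissible estimators for decreasing and increasing \<open>\<psi>\<close>\<close>

theorem theorem4p1p1:
  fixes f :: "real \<times> real \<Rightarrow> real" and \<nu> :: real
  assumes f_meas: "f \<in> borel_measurable borel"
    and f_nonneg: "\<And>x. 0 \<le> f x"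
    and f_supp: "\<And>x1 x2. \<not> (0 < x1 \<and> 0 < x2) \<Longrightarrow> f (x1, x2) = 0"
    and f_prob: "(\<integral>\<^sup>+ x. ennreal (f x) \<partial>lborel) = 1"
    and moment1: "integrable (law_Z f) (\<lambda>z. (fst z)\<^sup>2)"
    and moment2: "integrable (law_Z f) (\<lambda>z. (snd z)\<^sup>2)"
    and nu_pos: "0 < \<nu>"
    and f_Z_finite: "\<And>z. z \<in> {0<..<c01 f / \<nu>} \<Longrightarrow>
          set_integrable lborel {0<..} (\<lambda>s. s * f (s, s * z))"
    and f_Z_pos: "\<And>z. z \<in> {0<..<c01 f / \<nu>} \<Longrightarrow> 0 < f_Z f z"
    and psi_finite: "\<And>z r. z \<in> {0<..<c01 f / \<nu>} \<Longrightarrow> r \<in> {1, 2} \<Longrightarrow>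
          set_integrable lborel {0<..} (\<lambda>s. s ^ (r + 1) * f (s, s * z))"
  shows
    "(antimono_on {0<..<c01 f / \<nu>} (psi f) \<and>
      ((\<forall>\<theta>\<in>{0<..<1}. mono_on {0<..<c01 f / \<nu>} (\<lambda>t. psi_r f 2 (\<theta> * t) / psi_r f 2 t) \<and>
                       mono_on {0<..<c01 f / \<nu>} (\<lambda>t. f_Z f (\<theta> * t) / f_Z f t)) \<and>
       (\<forall>l\<ge>1. mono_on {0<..<1} (\<lambda>z. k1 f \<nu> z l))
       \<or>
       (\<forall>\<theta>\<in>{0<..<1}. antimono_on {0<..<c01 f / \<nu>} (\<lambda>t. psi_r f 2 (\<theta> * t) / psi_r f 2 t) \<and>
                       antimono_on {0<..<c01 f / \<nu>} (\<lambda>t. f_Z f (\<theta> * t) / f_Z f t)) \<and>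
       (\<forall>l\<ge>1. antimono_on {0<..<1} (\<lambda>z. k1 f \<nu> z l)))
      \<longrightarrow>
      ((\<lambda>l. ereal (alpha1 f \<nu> l)) \<longlongrightarrow> alpha1_inf f \<nu>) at_top \<and>
      {\<delta>. admissible_within f (D1 f \<nu>) \<delta>} =
        {delta f \<nu> \<alpha> |\<alpha>. ereal (alpha1 f \<nu> 1) \<le> ereal \<alpha> \<and> ereal \<alpha> \<le> alpha1_inf f \<nu>} \<and>
      (\<forall>a b. (a < b \<and> ereal b \<le> ereal (alpha1 f \<nu> 1)) \<or> (alpha1_inf f \<nu> \<le> ereal b \<and> b < a) \<longrightarrow>
         (\<forall>\<theta>\<in>Theta0. R1 f \<theta> (delta f \<nu> b) \<le> R1 f \<theta> (delta f \<nu> a))))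
     \<and>
     (mono_on {0<..<c01 f / \<nu>} (psi f) \<and>
      ((\<forall>\<theta>\<in>{0<..<1}. mono_on {0<..<c01 f / \<nu>} (\<lambda>t. psi_r f 2 (\<theta> * t) / psi_r f 2 t) \<and>
                       mono_on {0<..<c01 f / \<nu>} (\<lambda>t. f_Z f (\<theta> * t) / f_Z f t)) \<and>
       (\<forall>l\<ge>1. antimono_on {0<..<1} (\<lambda>z. k1 f \<nu> z l))
       \<or>
       (\<forall>\<theta>\<in>{0<..<1}. antimono_on {0<..<c01 f / \<nu>} (\<lambda>t. psi_r f 2 (\<theta> * t) / psi_r f 2 t) \<and>
                       antimono_on {0<..<c01 f / \<nu>} (\<lambda>t. f_Z f (\<theta> * t) / f_Z f t)) \<and>
       (\<forall>l\<ge>1. mono_on {0<..<1} (\<lambda>z. k1 f \<nu> z l)))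
      \<longrightarrow>
      ((\<lambda>l. ereal (alpha1 f \<nu> l)) \<longlongrightarrow> alpha1_inf f \<nu>) at_top \<and>
      {\<delta>. admissible_within f (D1 f \<nu>) \<delta>} =
        {delta f \<nu> \<alpha> |\<alpha>. alpha1_inf f \<nu> \<le> ereal \<alpha> \<and> ereal \<alpha> \<le> ereal (alpha1 f \<nu> 1)} \<and>
      (\<forall>a b. (a < b \<and> ereal b \<le> alpha1_inf f \<nu>) \<or> (ereal (alpha1 f \<nu> 1) \<le> ereal b \<and> b < a) \<longrightarrow>
         (\<forall>\<theta>\<in>Theta0. R1 f \<theta> (delta f \<nu> b) \<le> R1 f \<theta> (delta f \<nu> a))))"
proof -
  interpret scale_model f \<nu>
    by (unfold_locales; fact)
  show ?thesis
  proof (intro conjI impI; (elim conjE)?)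
    assume "antimono_on {0<..<m} (psi f)"
      and "(\<forall>\<theta>\<in>{0<..<1}. mono_on {0<..<m} (\<lambda>t. psi_r f 2 (\<theta> * t) / psi_r f 2 t) \<and>
                       mono_on {0<..<m} (\<lambda>t. f_Z f (\<theta> * t) / f_Z f t)) \<and>
       (\<forall>l\<ge>1. mono_on {0<..<1} (\<lambda>z. k1 f \<nu> z l))
       \<or>
       (\<forall>\<theta>\<in>{0<..<1}. antimono_on {0<..<m} (\<lambda>t. psi_r f 2 (\<theta> * t) / psi_r f 2 t) \<and>
                       antimono_on {0<..<m} (\<lambda>t. f_Z f (\<theta> * t) / f_Z f t)) \<and>
       (\<forall>l\<ge>1. antimono_on {0<..<1} (\<lambda>z. k1 f \<nu> z l))"
    note opt = mono_optimum[OF mono_alpha1[OF this], folded alpha1_inf_def]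
    show "((\<lambda>l. ereal (alpha1 f \<nu> l)) \<longlongrightarrow> alpha1_inf f \<nu>) at_top"
      by (rule opt(1))
    show "{\<delta>. admissible_within f (D1 f \<nu>) \<delta>} =
        {delta f \<nu> \<alpha> |\<alpha>. ereal (alpha1 f \<nu> 1) \<le> ereal \<alpha> \<and> ereal \<alpha> \<le> alpha1_inf f \<nu>}"
      by (rule admissible_set_eq[OF opt(2)])
    show "\<forall>a b. (a < b \<and> ereal b \<le> ereal (alpha1 f \<nu> 1)) \<or> (alpha1_inf f \<nu> \<le> ereal b \<and> b < a) \<longrightarrow>
         (\<forall>\<theta>\<in>Theta0. R1 f \<theta> (delta f \<nu> b) \<le> R1 f \<theta> (delta f \<nu> a))"
      unfolding Theta0_iff_ratio using opt(3) by blast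
  next
    assume "mono_on {0<..<m} (psi f)"
      and "(\<forall>\<theta>\<in>{0<..<1}. mono_on {0<..<m} (\<lambda>t. psi_r f 2 (\<theta> * t) / psi_r f 2 t) \<and>
                       mono_on {0<..<m} (\<lambda>t. f_Z f (\<theta> * t) / f_Z f t)) \<and>
       (\<forall>l\<ge>1. antimono_on {0<..<1} (\<lambda>z. k1 f \<nu> z l))
       \<or>
       (\<forall>\<theta>\<in>{0<..<1}. antimono_on {0<..<m} (\<lambda>t. psi_r f 2 (\<theta> * t) / psi_r f 2 t) \<and>
                       antimono_on {0<..<m} (\<lambda>t. f_Z f (\<theta> * t) / f_Z f t)) \<and>
       (\<forall>l\<ge>1. mono_on {0<..<1} (\<lambda>z. k1 f \<nu> z l))"
    note opt = antimono_optimum[OF antimono_alpha1[OF this], folded alpha1_inf_def]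
    show "((\<lambda>l. ereal (alpha1 f \<nu> l)) \<longlongrightarrow> alpha1_inf f \<nu>) at_top"
      by (rule opt(1))
    show "{\<delta>. admissible_within f (D1 f \<nu>) \<delta>} =
        {delta f \<nu> \<alpha> |\<alpha>. alpha1_inf f \<nu> \<le> ereal \<alpha> \<and> ereal \<alpha> \<le> ereal (alpha1 f \<nu> 1)}"
      by (rule admissible_set_eq[OF opt(2)])
    show "\<forall>a b. (a < b \<and> ereal b \<le> alpha1_inf f \<nu>) \<or> (ereal (alpha1 f \<nu> 1) \<le> ereal b \<and> b < a) \<longrightarrow>
         (\<forall>\<theta>\<in>Theta0. R1 f \<theta> (delta f \<nu> b) \<le> R1 f \<theta> (delta f \<nu> a))"
      unfolding Theta0_iff_ratio using opt(3) by blast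
  qed
qed

end
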